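(* Let $n,k$ be positive integers and let $m=kn+1$. Then a subset $\Omega\subset\{1,\dots,n\}\times\{1,\dots,m\}$ is the support of an extremal array $A\in\mathcal{S}_{n,m}$ if and only if the following two conditions hold: (i) for each $1\leq i\leq n$, the set $\{j:(i,j)\in\Omega\}$ contains exactly $k+1$ elements; (ii) $\Omega$ does not contain any "cycle", that is, there is no sequence of elements of $\Omega$ of the form $$(i_1,j_1),\;(i_2,j_1),\;(i_2,j_2),\;(i_3,j_2),\;\dots,\;(i_s,j_s),\;(i_1,j_s)\qquad(s\geq 2)$$ where $i_1,\dots,i_s$ are distinct row indices and $j_1,\dots,j_s$ are distinct column indices.
   Context: An $n\times m$ real matrix $A=(a_{ij})$ is called a doubly stochastic array (with uniform marginals) if $a_{ij}\geq 0$ for all $i,j$, $\sum_{j=1}^m a_{ij}=m$ for every $1\leq i\leq n$, and $\sum_{i=1}^n a_{ij}=n$ for every $1\leq j\leq m$. The set of all such arrays is denoted $\mathcal{S}_{n,m}$; it is a convex polytope. An array $A\in\mathcal{S}_{n,m}$ is called extremal if it is an extreme point of $\mathcal{S}_{n,m}$, i.e. it cannot be represented as a convex combination of two other elements of $\mathcal{S}_{n,m}$ that are both different from $A$. The support of a matrix $A=(a_{ij})$ is $\operatorname{supp}A=\{(i,j): a_{ij}\neq 0\}$. *)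

theory Defs
  imports "HOL-Analysis.Analysis"
begin

definition doubly_stochastic_arrays :: "(real ^ 'm ^ 'n) set" where
  "doubly_stochastic_arrays =
     {A. (\<forall>i j. 0 \<le> A $ i $ j) \<and>
         (\<forall>i. (\<Sum>j\<in>UNIV. A $ i $ j) = real CARD('m)) \<and>
         (\<forall>j. (\<Sum>i\<in>UNIV. A $ i $ j) = real CARD('n))}"

definition extremal_array :: "real ^ 'm ^ 'n \<Rightarrow> bool" where
  "extremal_array A \<longleftrightarrow> A extreme_point_of doubly_stochastic_arrays"

definition matrix_support :: "real ^ 'm ^ 'n \<Rightarrow> ('n \<times> 'm) set" where
  "matrix_support A = {(i, j). A $ i $ j \<noteq> 0}"

(* The sequence (r 1, c 1), (r 2, c 1), (r 2, c 2), (r 3, c 2), ..., (r s, c s), (r 1, c s). *)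
definition contains_cycle :: "('n \<times> 'm) set \<Rightarrow> bool" where
  "contains_cycle \<Omega> \<longleftrightarrow>
     (\<exists>s\<ge>2. \<exists>(r :: nat \<Rightarrow> 'n) (c :: nat \<Rightarrow> 'm).
        inj_on r {1..s} \<and> inj_on c {1..s} \<and>
        (\<forall>t\<in>{1..s}. (r t, c t) \<in> \<Omega>) \<and>
        (\<forall>t\<in>{1..<s}. (r (t + 1), c t) \<in> \<Omega>) \<and>
        (r 1, c s) \<in> \<Omega>)"

end

theory Submission
  imports Defs
begin

text \<open>
  Read a subset \<open>\<Omega>\<close> of rows \<open>\<times>\<close> columns as the edge set of a bipartite graph; condition (ii) says that
  this graph is a forest.  Two facts about forests carry the proof.  Linear algebra: in a forest the
  only signed array with vanishing row and column sums is zero, so that marginals determine an array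
  (\<open>acyclic_circulation_eq_0\<close>), whereas a cycle carries a nonzero one
  (\<open>cycle_carries_circulation\<close>).  Counting: a forest has fewer edges than vertices, also after
  restriction to any nonempty set of rows and columns (\<open>acyclic_card_less\<close>).

  If \<open>A\<close> is extremal, its support is a forest, since otherwise \<open>A\<close> could be moved both ways along a
  circulation.  No entry exceeds the column sum \<open>n\<close>, so a row with sum \<open>k n + 1\<close> has at
  least \<open>k + 1\<close> nonzero entries.  As a forest has at most \<open>n + m - 1 = n (k + 1)\<close> edges, every
  row has exactly \<open>k + 1\<close>.

  Conversely, let \<open>\<Omega>\<close> be a forest with \<open>k + 1\<close> edges at each row.  If it were disconnected, the edge
  bounds for a component and for its complement would together force \<open>m \<ge> k n + 2\<close>; so
  \<open>\<Omega>\<close> is a spanning tree and carries an array with the required marginals.  To see that its entry at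
  an edge \<open>(i, j)\<close> is positive, delete that edge: if \<open>p\<close> rows and \<open>q\<close> columns are then connected to
  row \<open>i\<close>, the entry equals \<open>p m - q n\<close>, and the edge bound on the other side gives \<open>q \<le> k p\<close>,
  so the entry is at least \<open>p (m - k n) = p \<ge> 1\<close>.  The array is extremal because its
  marginals determine it among the arrays supported in \<open>\<Omega>\<close>.
\<close>

section \<open>Forests\<close>

lemma contains_cycle_mono:
  assumes "contains_cycle F" and "F \<subseteq> G"
  shows "contains_cycle G"
  using assms unfolding contains_cycle_def by (meson subsetD)

text \<open>
  A walk that alternates between rows and columns and never turns back can be continued for ever, so
  it must revisit a vertex.  A first return in the sense of the smallest time difference closes up to
  a cycle without further repetitions, whether the repeated vertex is a row or a column.
\<close>
lemma leafless_contains_cycle: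
  fixes F :: "('n::finite \<times> 'm::finite) set"
  assumes nonempty: "F \<noteq> {}"
    and col: "\<And>i j. (i, j) \<in> F \<Longrightarrow> \<exists>i'. i' \<noteq> i \<and> (i', j) \<in> F"
    and row: "\<And>i j. (i, j) \<in> F \<Longrightarrow> \<exists>j'. j' \<noteq> j \<and> (i, j') \<in> F"
  shows "contains_cycle F"
proof -
  \<comment> \<open>The walk visits row \<open>fst (e t)\<close>, then column \<open>snd (e t)\<close>, then row \<open>fst (e (Suc t))\<close>, and so on.\<close>
  have "\<exists>e. \<forall>t::nat. e t \<in> F \<and>
      (fst (e (Suc t)) \<noteq> fst (e t) \<and> snd (e (Suc t)) \<noteq> snd (e t) \<and> (fst (e (Suc t)), snd (e t)) \<in> F)"
  proof (rule dependent_nat_choice)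
    show "\<exists>x. x \<in> F" using nonempty by blast
  next
    fix x and t :: nat
    assume "x \<in> F"
    then obtain i' where "i' \<noteq> fst x" "(i', snd x) \<in> F" using col[of "fst x" "snd x"] by auto
    moreover from this obtain j' where "j' \<noteq> snd x" "(i', j') \<in> F" using row by blast
    ultimately show "\<exists>y. y \<in> F \<and> (fst y \<noteq> fst x \<and> snd y \<noteq> snd x \<and> (fst y, snd x) \<in> F)"
      by (intro exI[of _ "(i', j')"]) auto
  qed
  then obtain e where e: "\<And>t. e t \<in> F"
      and fst_step: "\<And>t. fst (e (Suc t)) \<noteq> fst (e t)"
      and snd_step: "\<And>t. snd (e (Suc t)) \<noteq> snd (e t)"
      and turn: "\<And>t. (fst (e (Suc t)), snd (e t)) \<in> F" by blast
  define P where
    "P = (\<lambda>s. s \<ge> 1 \<and> (\<exists>t. fst (e t) = fst (e (t + s)) \<or> snd (e t) = snd (e (t + s))))"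
  have "\<not> inj (\<lambda>t::nat. fst (e t))"
    using finite_imageD[of "\<lambda>t. fst (e t)" UNIV] by auto
  then obtain u v where "u < v" "fst (e u) = fst (e v)"
    by (metis injI linorder_neqE_nat)
  then have "P (v - u)" unfolding P_def by (intro conjI exI[of _ u]) auto
  then obtain s where s: "P s" and least: "\<And>s'. s' < s \<Longrightarrow> \<not> P s'"
    by (metis LeastI not_less_Least)
  have "s \<noteq> 1" using s fst_step snd_step unfolding P_def by (metis Suc_eq_plus1)
  with s have s2: "s \<ge> 2" unfolding P_def by auto
  have distinct: "fst (e t) \<noteq> fst (e t') \<and> snd (e t) \<noteq> snd (e t')"
    if "t < t'" "t' < t + s" for t t'
  proof -
    have "\<not> P (t' - t)" using least that by simp
    moreover have "t' = t + (t' - t)" using that by simp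
    ultimately show ?thesis unfolding P_def using that by (metis One_nat_def Suc_leI zero_less_diff)
  qed
  \<comment> \<open>The cycle consists of \<open>s\<close> consecutive times \<open>\<sigma> 1, \<dots>, \<sigma> s\<close>: they start at \<open>t\<close> if a row recurs,
    but at \<open>t + 1\<close> if a column recurs, as a cycle is listed with a row first.\<close>
  have cycle: "contains_cycle F"
    if mono: "\<And>q q'. 1 \<le> q \<Longrightarrow> q < q' \<Longrightarrow> q' \<le> s \<Longrightarrow> \<sigma> q < \<sigma> q' \<and> \<sigma> q' < \<sigma> q + s"
      and step: "\<And>q. 1 \<le> q \<Longrightarrow> \<sigma> (q + 1) = Suc (\<sigma> q)"
      and close: "(fst (e (\<sigma> 1)), snd (e (\<sigma> s))) \<in> F" for \<sigma> :: "nat \<Rightarrow> nat"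
  proof -
    have "fst (e (\<sigma> q)) \<noteq> fst (e (\<sigma> q')) \<and> snd (e (\<sigma> q)) \<noteq> snd (e (\<sigma> q'))"
      if "q \<in> {1..s}" "q' \<in> {1..s}" "q < q'" for q q'
      using distinct mono that by simp
    then have "inj_on (\<lambda>q. fst (e (\<sigma> q))) {1..s}" "inj_on (\<lambda>q. snd (e (\<sigma> q))) {1..s}"
      by (intro linorder_inj_onI; force)+
    moreover have "(fst (e (\<sigma> q)), snd (e (\<sigma> q))) \<in> F" for q using e by simp
    moreover have "(fst (e (\<sigma> (q + 1))), snd (e (\<sigma> q))) \<in> F" if "1 \<le> q" for q
      using step[OF that] turn by simp
    ultimately show ?thesis unfolding contains_cycle_def using s2 close
      by (intro exI[of _ s] conjI exI[of _ "\<lambda>q. fst (e (\<sigma> q))"] exI[of _ "\<lambda>q. snd (e (\<sigma> q))"]) auto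
  qed
  obtain t where "fst (e t) = fst (e (t + s)) \<or> snd (e t) = snd (e (t + s))"
    using s unfolding P_def by blast
  then show ?thesis
  proof
    assume "fst (e t) = fst (e (t + s))"
    then have "(fst (e t), snd (e (s - 1 + t))) \<in> F"
      using turn[of "s - 1 + t"] s2 by (simp add: add.commute)
    then show ?thesis by (intro cycle[of "\<lambda>q. q - 1 + t"]) auto
  next
    assume "snd (e t) = snd (e (t + s))"
    then have "(fst (e (1 + t)), snd (e (s + t))) \<in> F"
      using turn[of t] by (simp add: add.commute)
    then show ?thesis by (intro cycle[of "\<lambda>q. q + t"]) auto
  qed
qed

text \<open>
  Deleting a leaf removes one vertex and one edge, and a forest that still has edges has a leaf.
\<close>
lemma acyclic_card_less:
  fixes F :: "('n::finite \<times> 'm::finite) set"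
  assumes acyclic: "\<not> contains_cycle F" and "X \<noteq> {} \<or> Y \<noteq> {}"
  shows "card (F \<inter> X \<times> Y) < card X + card Y"
  using assms(2)
proof (induction "card X + card Y" arbitrary: X Y rule: less_induct)
  case less
  let ?G = "F \<inter> X \<times> Y"
  show ?case
  proof (cases "?G = {}")
    case True
    then show ?thesis using less.prems by (auto simp: card_gt_0_iff)
  next
    case False
    have "\<not> contains_cycle ?G" using acyclic contains_cycle_mono[of ?G F] by blast
    with False obtain i j where ij: "(i, j) \<in> ?G"
      and leaf: "(\<forall>i'. (i', j) \<in> ?G \<longrightarrow> i' = i) \<or> (\<forall>j'. (i, j') \<in> ?G \<longrightarrow> j' = j)"
      using leafless_contains_cycle[of ?G] by blast
    from leaf show ?thesis
    proof
      assume "\<forall>i'. (i', j) \<in> ?G \<longrightarrow> i' = i"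
      then have G: "?G = insert (i, j) (F \<inter> X \<times> (Y - {j}))" using ij by auto
      have Y: "card Y = Suc (card (Y - {j}))" using ij by (intro card.remove) auto
      have "card (F \<inter> X \<times> (Y - {j})) < card X + card (Y - {j})"
        using ij Y by (intro less.hyps) auto
      then show ?thesis unfolding G using Y by simp
    next
      assume "\<forall>j'. (i, j') \<in> ?G \<longrightarrow> j' = j"
      then have G: "?G = insert (i, j) (F \<inter> (X - {i}) \<times> Y)" using ij by auto
      have X: "card X = Suc (card (X - {i}))" using ij by (intro card.remove) auto
      have "card (F \<inter> (X - {i}) \<times> Y) < card (X - {i}) + card Y"
        using ij X by (intro less.hyps) auto
      then show ?thesis unfolding G using X by simp
    qed
  qed
qed

section \<open>Signed arrays with prescribed marginals\<close>

definition has_marginals ::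
  "('n::finite \<times> 'm::finite) set \<Rightarrow> ('n \<Rightarrow> 'm \<Rightarrow> real) \<Rightarrow> ('n \<Rightarrow> real) \<Rightarrow> ('m \<Rightarrow> real) \<Rightarrow> bool"
where
  "has_marginals F B r c \<longleftrightarrow>
     (\<forall>i j. B i j \<noteq> 0 \<longrightarrow> (i, j) \<in> F) \<and>
     (\<forall>i. (\<Sum>j\<in>UNIV. B i j) = r i) \<and> (\<forall>j. (\<Sum>i\<in>UNIV. B i j) = c j)"

abbreviation circulation :: "('n::finite \<times> 'm::finite) set \<Rightarrow> ('n \<Rightarrow> 'm \<Rightarrow> real) \<Rightarrow> bool" where
  "circulation F B \<equiv> has_marginals F B (\<lambda>_. 0) (\<lambda>_. 0)"

lemma has_marginals_subset:
  "has_marginals F B r c \<Longrightarrow> F \<subseteq> G \<Longrightarrow> has_marginals G B r c"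
  unfolding has_marginals_def by blast

lemma has_marginals_0: "circulation F (\<lambda>i j. 0)"
  unfolding has_marginals_def by simp

lemma has_marginals_add:
  assumes "has_marginals F B r c" and "has_marginals F B' r' c'"
  shows "has_marginals F (\<lambda>i j. B i j + B' i j) (\<lambda>i. r i + r' i) (\<lambda>j. c j + c' j)"
proof -
  have "(i, j) \<in> F" if "B i j + B' i j \<noteq> 0" for i j
    using assms that unfolding has_marginals_def by (cases "B i j = 0") auto
  then show ?thesis using assms unfolding has_marginals_def by (simp add: sum.distrib)
qed

lemma has_marginals_scale:
  assumes "has_marginals F B r c"
  shows "has_marginals F (\<lambda>i j. x * B i j) (\<lambda>i. x * r i) (\<lambda>j. x * c j)"
  using assms unfolding has_marginals_def by (simp flip: sum_distrib_left)

lemma has_marginals_diff: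
  assumes "has_marginals F B r c" and "has_marginals F B' r' c'"
  shows "has_marginals F (\<lambda>i j. B i j - B' i j) (\<lambda>i. r i - r' i) (\<lambda>j. c j - c' j)"
  using has_marginals_add[OF assms(1) has_marginals_scale[OF assms(2), of "-1"]] by simp

lemma has_marginals_sum:
  assumes "\<And>x. x \<in> S \<Longrightarrow> has_marginals F (B x) (r x) (c x)"
  shows "has_marginals F (\<lambda>i j. \<Sum>x\<in>S. B x i j) (\<lambda>i. \<Sum>x\<in>S. r x i) (\<lambda>j. \<Sum>x\<in>S. c x j)"
  using assms
proof (induction S rule: infinite_finite_induct)
  case (insert x S)
  then have "has_marginals F (B x) (r x) (c x)"
    and "has_marginals F (\<lambda>i j. \<Sum>x\<in>S. B x i j) (\<lambda>i. \<Sum>x\<in>S. r x i) (\<lambda>j. \<Sum>x\<in>S. c x j)"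
    by simp_all
  from has_marginals_add[OF this] show ?case using insert.hyps by simp
qed (simp_all add: has_marginals_0)

lemma has_marginals_single:
  assumes "(a, b) \<in> F"
  shows "has_marginals F (\<lambda>i j. of_bool (i = a \<and> j = b)) (\<lambda>i. of_bool (i = a)) (\<lambda>j. of_bool (j = b))"
  using assms unfolding has_marginals_def by (simp add: of_bool_conj flip: sum_distrib_left sum_distrib_right)

text \<open>
  A row or column of the support of a circulation cannot contain just one nonzero entry, so the
  support has no leaves.
\<close>
lemma acyclic_circulation_eq_0:
  fixes F :: "('n::finite \<times> 'm::finite) set"
  assumes acyclic: "\<not> contains_cycle F" and B: "circulation F B"
  shows "B i j = 0"
proof (rule ccontr)
  assume nz: "B i j \<noteq> 0"
  let ?G = "{(i, j). B i j \<noteq> 0}"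
  have "contains_cycle ?G"
  proof (rule leafless_contains_cycle)
    show "?G \<noteq> {}" using nz by auto
  next
    fix i j assume ij: "(i, j) \<in> ?G"
    have "(\<Sum>i'\<in>UNIV. B i' j) = B i j" if "\<forall>i'. i' \<noteq> i \<longrightarrow> B i' j = 0"
      using sum.mono_neutral_right[of UNIV "{i}" "\<lambda>i'. B i' j"] that by auto
    then show "\<exists>i'. i' \<noteq> i \<and> (i', j) \<in> ?G" using ij B unfolding has_marginals_def by auto
  next
    fix i j assume ij: "(i, j) \<in> ?G"
    have "(\<Sum>j'\<in>UNIV. B i j') = B i j" if "\<forall>j'. j' \<noteq> j \<longrightarrow> B i j' = 0"
      using sum.mono_neutral_right[of UNIV "{j}" "\<lambda>j'. B i j'"] that by auto
    then show "\<exists>j'. j' \<noteq> j \<and> (i, j') \<in> ?G" using ij B unfolding has_marginals_def by auto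
  qed
  moreover have "?G \<subseteq> F" using B unfolding has_marginals_def by blast
  ultimately show False using acyclic contains_cycle_mono by blast
qed

text \<open>The circulation is \<open>1\<close> and \<open>-1\<close> alternately along the cycle.\<close>
lemma cycle_carries_circulation:
  fixes F :: "('n::finite \<times> 'm::finite) set"
  assumes "contains_cycle F"
  obtains B i j where "circulation F B" and "B i j \<noteq> 0"
proof -
  obtain s and r :: "nat \<Rightarrow> 'n" and c :: "nat \<Rightarrow> 'm" where s2: "s \<ge> 2"
    and injr: "inj_on r {1..s}" and injc: "inj_on c {1..s}"
    and e1: "\<And>t. t \<in> {1..s} \<Longrightarrow> (r t, c t) \<in> F"
    and e2: "\<And>t. t \<in> {1..<s} \<Longrightarrow> (r (t + 1), c t) \<in> F"
    and e3: "(r 1, c s) \<in> F"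
    using assms unfolding contains_cycle_def by blast
  define nxt where "nxt = (\<lambda>t. if t = s then 1 else t + 1)"
  have bij: "bij_betw nxt {1..s} {1..s}"
    by (rule bij_betw_byWitness[where f' = "\<lambda>t. if t = 1 then s else t - 1"])
      (use s2 in \<open>auto simp: nxt_def\<close>)
  have nxt_edge: "(r (nxt t), c t) \<in> F" if "t \<in> {1..s}" for t
    using that e2[of t] e3 by (auto simp: nxt_def)
  define B where "B = (\<lambda>i j. \<Sum>t\<in>{1..s}. of_bool (i = r t \<and> j = c t)
                                          - of_bool (i = r (nxt t) \<and> j = c t) :: real)"
  have "has_marginals F B (\<lambda>i. \<Sum>t\<in>{1..s}. of_bool (i = r t) - of_bool (i = r (nxt t)))
                          (\<lambda>j. \<Sum>t\<in>{1..s}. of_bool (j = c t) - of_bool (j = c t))"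
    unfolding B_def
    by (intro has_marginals_sum has_marginals_diff has_marginals_single e1 nxt_edge)
  moreover have "(\<Sum>t\<in>{1..s}. of_bool (i = r t) - of_bool (i = r (nxt t)) :: real) = 0" for i
    using sum.reindex_bij_betw[OF bij, of "\<lambda>t. of_bool (i = r t) :: real"]
    by (simp add: sum_subtractf)
  ultimately have "circulation F B" by simp
  moreover have "B (r 1) (c 1) = 1"
  proof -
    have "r 1 \<noteq> r (nxt 1)" using inj_onD[OF injr, of 1 2] s2 by (auto simp: nxt_def numeral_2_eq_2)
    moreover have "c 1 \<noteq> c t" if "t \<in> {1..s} - {1}" for t
      using inj_onD[OF injc, of 1 t] that by auto
    ultimately show ?thesis
      unfolding B_def using s2 by (subst sum.remove[of _ 1]) (auto intro!: sum.neutral)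
  qed
  ultimately show thesis using that[of B "r 1" "c 1"] by simp
qed

section \<open>Connected components\<close>

text \<open>
  The two sets below are the rows and the columns of the connected component of row \<open>a\<close>, described
  through unit transfers: an alternating sum of \<open>\<plusminus> 1\<close> along a path leaves marginals only at the two
  ends of the path.  This form replaces paths by linear algebra: it adds up directly to arrays
  with given marginals, and contradicts acyclicity through \<open>acyclic_circulation_eq_0\<close> even when the
  underlying walk repeats vertices.
\<close>
definition component_rows :: "('n::finite \<times> 'm::finite) set \<Rightarrow> 'n \<Rightarrow> 'n set" where
  "component_rows F a =
     {x. \<exists>B. has_marginals F B (\<lambda>i. of_bool (i = a) - of_bool (i = x)) (\<lambda>_. 0)}"

definition component_cols :: "('n::finite \<times> 'm::finite) set \<Rightarrow> 'n \<Rightarrow> 'm set" where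
  "component_cols F a =
     {y. \<exists>B. has_marginals F B (\<lambda>i. of_bool (i = a)) (\<lambda>j. of_bool (j = y))}"

lemma component_rows_base: "a \<in> component_rows F a"
  unfolding component_rows_def using has_marginals_0 by force

lemma component_edge:
  assumes "(x, y) \<in> F"
  shows "x \<in> component_rows F a \<longleftrightarrow> y \<in> component_cols F a"
proof
  assume "x \<in> component_rows F a"
  then obtain B where "has_marginals F B (\<lambda>i. of_bool (i = a) - of_bool (i = x)) (\<lambda>_. 0)"
    unfolding component_rows_def by blast
  from has_marginals_add[OF this has_marginals_single[OF assms]]
  show "y \<in> component_cols F a" unfolding component_cols_def by auto
next
  assume "y \<in> component_cols F a"
  then obtain B where "has_marginals F B (\<lambda>i. of_bool (i = a)) (\<lambda>j. of_bool (j = y))"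
    unfolding component_cols_def by blast
  from has_marginals_diff[OF this has_marginals_single[OF assms]]
  show "x \<in> component_rows F a" unfolding component_rows_def by auto
qed

text \<open>
  In a connected graph the total can be routed through a single row \<open>a\<close>: ship \<open>c y\<close> from \<open>a\<close> to each
  column \<open>y\<close>, and \<open>r x\<close> from each row \<open>x\<close> to \<open>a\<close>.
\<close>
lemma connected_has_marginals:
  fixes F :: "('n::finite \<times> 'm::finite) set"
  assumes rows: "component_rows F a = UNIV" and cols: "component_cols F a = UNIV"
    and balanced: "(\<Sum>i\<in>UNIV. r i) = (\<Sum>j\<in>UNIV. c j)"
  obtains B where "has_marginals F B r c"
proof -
  obtain R where
    R: "\<And>x. has_marginals F (R x) (\<lambda>i. of_bool (i = a) - of_bool (i = x)) (\<lambda>_. 0)"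
    using rows unfolding component_rows_def set_eq_iff by simp metis
  obtain C where
    C: "\<And>y. has_marginals F (C y) (\<lambda>i. of_bool (i = a)) (\<lambda>j. of_bool (j = y))"
    using cols unfolding component_cols_def set_eq_iff by simp metis
  have "has_marginals F
      (\<lambda>i j. (\<Sum>y\<in>UNIV. c y * C y i j) - (\<Sum>x\<in>UNIV. r x * R x i j))
      (\<lambda>i. (\<Sum>y\<in>UNIV. c y * of_bool (i = a)) - (\<Sum>x\<in>UNIV. r x * (of_bool (i = a) - of_bool (i = x))))
      (\<lambda>j. (\<Sum>y\<in>UNIV. c y * of_bool (j = y)) - (\<Sum>x\<in>UNIV. r x * 0))"
    by (intro has_marginals_diff has_marginals_sum has_marginals_scale R C)
  moreover have "(\<Sum>y\<in>UNIV. c y * of_bool (i = a))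
      - (\<Sum>x\<in>UNIV. r x * (of_bool (i = a) - of_bool (i = x))) = r i" for i
    using balanced
    by (simp add: right_diff_distrib sum_subtractf sum_distrib_right[symmetric])
  ultimately show thesis using that by simp
qed

section \<open>Forests with equally many edges at each row\<close>

lemma card_add_card_Compl: "card X + card (- X) = CARD('a)" for X :: "'a::finite set"
  by (simp flip: card_Un_disjoint)

lemma card_edges_from_rows:
  fixes F :: "('n::finite \<times> 'm::finite) set"
  assumes deg: "\<And>i. i \<in> X \<Longrightarrow> card {j. (i, j) \<in> F} = d"
    and closed: "\<And>i j. (i, j) \<in> F \<Longrightarrow> i \<in> X \<Longrightarrow> j \<in> Y"
  shows "card (F \<inter> X \<times> Y) = d * card X"
proof -
  have "F \<inter> X \<times> Y = Sigma X (\<lambda>i. {j. (i, j) \<in> F})" using closed by auto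
  then show ?thesis using deg by (simp add: card_SigmaI)
qed

text \<open>
  The rows in \<open>X\<close> keep all their \<open>k + 1\<close> edges when the forest is restricted to \<open>X \<times> Y\<close>; the edge bound
  \<open>(k + 1) |X| < |X| + |Y|\<close> then compares the number of columns with that of rows.
\<close>
lemma regular_acyclic_less:
  fixes F :: "('n::finite \<times> 'm::finite) set"
  assumes "\<not> contains_cycle F" and "\<And>i. card {j. (i, j) \<in> F} = k + 1"
    and "\<And>i j. (i, j) \<in> F \<Longrightarrow> i \<in> X \<Longrightarrow> j \<in> Y" and "X \<noteq> {} \<or> Y \<noteq> {}"
  shows "k * card X < card Y"
  using acyclic_card_less[OF assms(1,4)] card_edges_from_rows[of X F "k + 1" Y] assms(2,3) by simp

text \<open>
  Both a component and its complement would have more than \<open>k\<close> times as many columns as rows.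
\<close>
lemma regular_acyclic_connected:
  fixes F :: "('n::finite \<times> 'm::finite) set"
  assumes acyclic: "\<not> contains_cycle F" and deg: "\<And>i. card {j. (i, j) \<in> F} = k + 1"
    and size: "CARD('m) = k * CARD('n) + 1"
  shows "component_rows F a = UNIV" and "component_cols F a = UNIV"
proof -
  let ?X = "component_rows F a" and ?Y = "component_cols F a"
  have inside: "k * card ?X < card ?Y"
    using component_rows_base
    by (intro regular_acyclic_less[OF acyclic deg]) (auto simp: component_edge)
  have "- ?X = {} \<and> - ?Y = {}"
  proof (rule ccontr)
    assume "\<not> (- ?X = {} \<and> - ?Y = {})"
    then have "k * card (- ?X) < card (- ?Y)"
      by (intro regular_acyclic_less[OF acyclic deg]) (auto simp: component_edge)
    with inside have "k * (card ?X + card (- ?X)) + 2 \<le> card ?Y + card (- ?Y)"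
      by (simp add: distrib_left)
    moreover have "card ?X + card (- ?X) = CARD('n)" "card ?Y + card (- ?Y) = CARD('m)"
      by (rule card_add_card_Compl)+
    ultimately show False using size by simp
  qed
  then show "?X = UNIV" "?Y = UNIV" by auto
qed

text \<open>
  Delete the edge \<open>(i, j)\<close>, and let \<open>X\<close>, \<open>Y\<close> be the rows and columns still connected to row \<open>i\<close>; by
  acyclicity \<open>j \<notin> Y\<close>.  Apart from the entry at \<open>(i, j)\<close>, the rows in \<open>X\<close> and the columns in \<open>Y\<close>
  contain the same nonzero entries, so comparison of their sums evaluates that entry.
\<close>
lemma regular_acyclic_array_pos:
  fixes F :: "('n::finite \<times> 'm::finite) set"
  assumes acyclic: "\<not> contains_cycle F" and deg: "\<And>i. card {j. (i, j) \<in> F} = k + 1"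
    and size: "CARD('m) = k * CARD('n) + 1"
    and A: "has_marginals F A (\<lambda>_. real CARD('m)) (\<lambda>_. real CARD('n))"
    and ij: "(i, j) \<in> F"
  shows "A i j > 0"
proof -
  define G where "G = F - {(i, j)}"
  define X where "X = component_rows G i"
  define Y where "Y = component_cols G i"
  have iX: "i \<in> X" unfolding X_def by (rule component_rows_base)
  have jY: "j \<notin> Y"
  proof
    assume "j \<in> Y"
    then obtain B where B: "has_marginals G B (\<lambda>x. of_bool (x = i)) (\<lambda>y. of_bool (y = j))"
      unfolding Y_def component_cols_def by blast
    then have "has_marginals F B (\<lambda>x. of_bool (x = i)) (\<lambda>y. of_bool (y = j))"
      by (rule has_marginals_subset) (auto simp: G_def)
    from has_marginals_diff[OF this has_marginals_single[OF ij]]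
    have "circulation F (\<lambda>x y. B x y - of_bool (x = i \<and> y = j))" by simp
    from acyclic_circulation_eq_0[OF acyclic this, of i j] have "B i j = 1" by simp
    then show False using B unfolding has_marginals_def G_def by force
  qed
  have edge: "x \<in> X \<longleftrightarrow> y \<in> Y" if "(x, y) \<in> F" "(x, y) \<noteq> (i, j)" for x y
    unfolding X_def Y_def using that by (intro component_edge) (simp add: G_def)
  have off: "A x y = 0" if "(x \<in> X) \<noteq> (y \<in> Y)" "(x, y) \<noteq> (i, j)" for x y
    using A edge[of x y] that unfolding has_marginals_def by blast
  have "real (card X) * real CARD('m) = (\<Sum>x\<in>X. \<Sum>y\<in>UNIV. A x y)"
    using A unfolding has_marginals_def by simp
  also have "\<dots> = (\<Sum>x\<in>X. (\<Sum>y\<in>Y. A x y) + of_bool (x = i) * A i j)"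
  proof (rule sum.cong)
    fix x assume x: "x \<in> X"
    have "(\<Sum>y\<in>UNIV. A x y) = (\<Sum>y\<in>Y. A x y) + (\<Sum>y\<in>- Y. A x y)"
      by (simp add: sum.subset_diff[of Y UNIV] Compl_eq_Diff_UNIV)
    also have "(\<Sum>y\<in>- Y. A x y) = (\<Sum>y\<in>- Y. of_bool (y = j) * (of_bool (x = i) * A i j))"
      using off[of x] x by (intro sum.cong) auto
    also have "\<dots> = of_bool (x = i) * A i j"
      using jY by (simp add: sum_distrib_right[symmetric])
    finally show "(\<Sum>y\<in>UNIV. A x y) = (\<Sum>y\<in>Y. A x y) + of_bool (x = i) * A i j" .
  qed simp
  also have "\<dots> = (\<Sum>x\<in>X. \<Sum>y\<in>Y. A x y) + A i j"
    using iX by (simp add: sum.distrib sum_distrib_right[symmetric])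
  also have "(\<Sum>x\<in>X. \<Sum>y\<in>Y. A x y) = (\<Sum>y\<in>Y. \<Sum>x\<in>X. A x y)" by (rule sum.swap)
  also have "\<dots> = (\<Sum>y\<in>Y. \<Sum>x\<in>UNIV. A x y)"
    using off jY by (intro sum.cong sum.mono_neutral_left ballI) auto
  also have "\<dots> = real (card Y) * real CARD('n)"
    using A unfolding has_marginals_def by simp
  finally have entry: "A i j = real (card X) * real CARD('m) - real (card Y) * real CARD('n)"
    by simp
  \<comment> \<open>The edge bound is applied to the side of \<open>j\<close>, since only there do all \<open>k + 1\<close> edges of every row
    survive the deletion.\<close>
  have "k * card (- X) < card (- Y)"
    using edge jY iX by (intro regular_acyclic_less[OF acyclic deg]) auto
  moreover have "card X + card (- X) = CARD('n)" "card Y + card (- Y) = CARD('m)"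
    by (rule card_add_card_Compl)+
  ultimately have "k * card (- X) + card Y < k * (card X + card (- X)) + 1" using size by simp
  then have "card Y \<le> k * card X" by (simp add: distrib_left)
  then have "card Y * CARD('n) \<le> k * card X * CARD('n)" by (rule mult_right_mono) simp
  also have "\<dots> < k * card X * CARD('n) + card X" using iX by (auto simp: card_gt_0_iff)
  also have "\<dots> = card X * CARD('m)" unfolding size by (simp add: algebra_simps)
  finally have "card Y * CARD('n) < card X * CARD('m)" .
  then show ?thesis unfolding entry by (simp flip: of_nat_mult)
qed

section \<open>Extremal arrays\<close>

lemma doubly_stochastic_has_marginals:
  fixes A :: "real ^ 'm::finite ^ 'n::finite"
  assumes "A \<in> doubly_stochastic_arrays" and "matrix_support A \<subseteq> F"
  shows "has_marginals F (\<lambda>i j. A $ i $ j) (\<lambda>_. real CARD('m)) (\<lambda>_. real CARD('n))"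
  using assms unfolding doubly_stochastic_arrays_def matrix_support_def has_marginals_def by auto

text \<open>A small multiple of a circulation on the support can be both added and subtracted.\<close>
lemma extremal_array_acyclic:
  fixes A :: "real ^ 'm::finite ^ 'n::finite"
  assumes "extremal_array A"
  shows "\<not> contains_cycle (matrix_support A)"
proof
  assume "contains_cycle (matrix_support A)"
  then obtain B i0 j0 where B: "circulation (matrix_support A) B" and nz: "B i0 j0 \<noteq> 0"
    by (rule cycle_carries_circulation)
  have A: "A \<in> doubly_stochastic_arrays"
    using assms unfolding extremal_array_def extreme_point_of_def by blast
  then have nonneg: "A $ i $ j \<ge> 0" for i j unfolding doubly_stochastic_arrays_def by blast
  define E where "E = insert 1 ((\<lambda>(i, j). A $ i $ j / \<bar>B i j\<bar>) ` {(i, j). B i j \<noteq> 0})"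
  define \<epsilon> where "\<epsilon> = Min E"
  have "A $ i $ j / \<bar>B i j\<bar> > 0" if "B i j \<noteq> 0" for i j
    using that B nonneg[of i j] unfolding has_marginals_def matrix_support_def
    by (auto simp: less_le)
  then have "\<epsilon> > 0" unfolding \<epsilon>_def E_def by auto
  have small: "\<epsilon> * \<bar>B i j\<bar> \<le> A $ i $ j" for i j
  proof (cases "B i j = 0")
    case False
    then have "\<epsilon> \<le> A $ i $ j / \<bar>B i j\<bar>" unfolding \<epsilon>_def E_def by (intro Min_le) auto
    then show ?thesis using False by (simp add: field_simps)
  qed (use nonneg in simp)
  define D :: "real ^ 'm ^ 'n" where "D = (\<chi> i j. \<epsilon> * B i j)"
  have in_S: "A + x *\<^sub>R D \<in> doubly_stochastic_arrays" if "\<bar>x\<bar> = 1" for x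
  proof -
    have "\<bar>x * (\<epsilon> * B i j)\<bar> \<le> A $ i $ j" for i j
      using small[of i j] \<open>\<epsilon> > 0\<close> that by (simp add: abs_mult)
    then have "0 \<le> A $ i $ j + x * (\<epsilon> * B i j)" for i j
      by (smt (verit))
    then show ?thesis
      using A B unfolding doubly_stochastic_arrays_def has_marginals_def D_def
      by (simp add: sum.distrib sum_distrib_left[symmetric])
  qed
  have "D $ i0 $ j0 \<noteq> 0" using nz \<open>\<epsilon> > 0\<close> unfolding D_def by simp
  then have "D \<noteq> 0" by auto
  have "A = (1 - 1/2) *\<^sub>R (A + 1 *\<^sub>R D) + (1/2) *\<^sub>R (A + (-1) *\<^sub>R D)"
    by (simp add: algebra_simps flip: scaleR_add_left)
  moreover have "A + 1 *\<^sub>R D \<noteq> A + (-1) *\<^sub>R D"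
    using \<open>D \<noteq> 0\<close> by (simp add: eq_neg_iff_add_eq_0 flip: scaleR_2)
  ultimately have "A \<in> open_segment (A + 1 *\<^sub>R D) (A + (-1) *\<^sub>R D)"
    unfolding in_segment by (intro conjI exI[of _ "1/2"]) auto
  then show False
    using assms in_S[of 1] in_S[of "-1"] unfolding extremal_array_def extreme_point_of_def by auto
qed

text \<open>
  Arrays whose segment contains \<open>A\<close> have their support inside that of \<open>A\<close>, so their difference is a
  circulation on a forest.
\<close>
lemma acyclic_support_extremal:
  fixes A :: "real ^ 'm::finite ^ 'n::finite"
  assumes A: "A \<in> doubly_stochastic_arrays" and acyclic: "\<not> contains_cycle (matrix_support A)"
  shows "extremal_array A"
  unfolding extremal_array_def extreme_point_of_def
proof (intro conjI ballI notI)
  fix P Q :: "real ^ 'm ^ 'n"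
  assume P: "P \<in> doubly_stochastic_arrays" and Q: "Q \<in> doubly_stochastic_arrays"
    and "A \<in> open_segment P Q"
  then obtain u where "P \<noteq> Q" and u: "0 < u" "u < 1" and AE: "A = (1 - u) *\<^sub>R P + u *\<^sub>R Q"
    unfolding in_segment by blast
  have "P $ i $ j = 0 \<and> Q $ i $ j = 0" if "A $ i $ j = 0" for i j
  proof -
    have "(1 - u) * P $ i $ j \<ge> 0" "u * Q $ i $ j \<ge> 0"
      using P Q u unfolding doubly_stochastic_arrays_def by auto
    moreover have "(1 - u) * P $ i $ j + u * Q $ i $ j = 0" using that unfolding AE by simp
    ultimately have "(1 - u) * P $ i $ j = 0" "u * Q $ i $ j = 0" by linarith+
    then show ?thesis using u by simp
  qed
  then have "matrix_support P \<subseteq> matrix_support A" "matrix_support Q \<subseteq> matrix_support A"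
    unfolding matrix_support_def by auto
  from has_marginals_diff[OF doubly_stochastic_has_marginals[OF P this(1)]
      doubly_stochastic_has_marginals[OF Q this(2)]]
  have "circulation (matrix_support A) (\<lambda>i j. P $ i $ j - Q $ i $ j)" by simp
  from acyclic_circulation_eq_0[OF acyclic this] have "P = Q" by (simp add: vec_eq_iff)
  with \<open>P \<noteq> Q\<close> show False by contradiction
qed (fact A)

text \<open>No entry exceeds the sum of its column.\<close>
lemma doubly_stochastic_row_support:
  fixes A :: "real ^ 'm::finite ^ 'n::finite"
  assumes A: "A \<in> doubly_stochastic_arrays"
  shows "CARD('m) \<le> card {j. (i, j) \<in> matrix_support A} * CARD('n)"
proof -
  have le: "A $ i $ j \<le> real CARD('n)" for j
    using A member_le_sum[of i UNIV "\<lambda>i. A $ i $ j"] unfolding doubly_stochastic_arrays_def by auto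
  have "real CARD('m) = (\<Sum>j\<in>UNIV. A $ i $ j)" using A unfolding doubly_stochastic_arrays_def by auto
  also have "\<dots> = (\<Sum>j\<in>{j. (i, j) \<in> matrix_support A}. A $ i $ j)"
    unfolding matrix_support_def by (intro sum.mono_neutral_right) auto
  also have "\<dots> \<le> real (card {j. (i, j) \<in> matrix_support A}) * real CARD('n)"
    using le by (intro sum_bounded_above) auto
  finally show ?thesis by (simp flip: of_nat_mult)
qed

text \<open>The edge bound allows no row to exceed the minimal number \<open>k + 1\<close> of nonzero entries.\<close>
lemma extremal_array_row_support:
  fixes A :: "real ^ 'm::finite ^ 'n::finite"
  assumes ext: "extremal_array A" and size: "CARD('m) = k * CARD('n) + 1"
  shows "card {j. (i, j) \<in> matrix_support A} = k + 1"
proof -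
  let ?d = "\<lambda>i. card {j. (i, j) \<in> matrix_support A}"
  have A: "A \<in> doubly_stochastic_arrays"
    using ext unfolding extremal_array_def extreme_point_of_def by blast
  have ge: "k + 1 \<le> ?d i" for i
  proof -
    have "k * CARD('n) < ?d i * CARD('n)"
      using doubly_stochastic_row_support[OF A, of i] size by linarith
    then show ?thesis by simp
  qed
  have "matrix_support A = Sigma UNIV (\<lambda>i. {j. (i, j) \<in> matrix_support A})" by auto
  also have "card \<dots> = (\<Sum>i\<in>UNIV. ?d i)" by (simp add: card_SigmaI)
  finally have "card (matrix_support A) = (\<Sum>i\<in>UNIV. ?d i)" .
  with acyclic_card_less[OF extremal_array_acyclic[OF ext], of UNIV UNIV]
  have "(\<Sum>i\<in>UNIV. ?d i) \<le> (\<Sum>i\<in>(UNIV::'n set). k + 1)" using size by (simp add: algebra_simps)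
  moreover have "(\<Sum>i\<in>(UNIV::'n set). k + 1) < (\<Sum>i\<in>UNIV. ?d i)" if "k + 1 < ?d i"
    using ge that by (intro sum_strict_mono_ex1) auto
  ultimately show ?thesis using ge[of i] by fastforce
qed

theorem theorem1p4:
  fixes n k m :: nat and \<Omega> :: "('n::finite \<times> 'm::finite) set"
  assumes "n = CARD('n)" and "m = CARD('m)"
    and "n \<ge> 1" and "k \<ge> 1" and "m = k * n + 1"
  shows "(\<exists>A :: real ^ 'm ^ 'n. extremal_array A \<and> matrix_support A = \<Omega>) \<longleftrightarrow>
         (\<forall>i. card {j. (i, j) \<in> \<Omega>} = k + 1) \<and> \<not> contains_cycle \<Omega>"
proof -
  have size: "CARD('m) = k * CARD('n) + 1" using assms by simp
  show ?thesis
  proof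
    assume "\<exists>A :: real ^ 'm ^ 'n. extremal_array A \<and> matrix_support A = \<Omega>"
    then show "(\<forall>i. card {j. (i, j) \<in> \<Omega>} = k + 1) \<and> \<not> contains_cycle \<Omega>"
      using extremal_array_row_support[OF _ size] extremal_array_acyclic by blast
  next
    assume "(\<forall>i. card {j. (i, j) \<in> \<Omega>} = k + 1) \<and> \<not> contains_cycle \<Omega>"
    then have deg: "\<And>i. card {j. (i, j) \<in> \<Omega>} = k + 1" and acyclic: "\<not> contains_cycle \<Omega>" by auto
    obtain B where B: "has_marginals \<Omega> B (\<lambda>_. real CARD('m)) (\<lambda>_. real CARD('n))"
      using connected_has_marginals[OF regular_acyclic_connected[OF acyclic deg size],
          of "\<lambda>_. real CARD('m)" "\<lambda>_. real CARD('n)"] by (auto simp: mult.commute)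
    define A :: "real ^ 'm ^ 'n" where "A = (\<chi> i j. B i j)"
    have pos: "B i j > 0" if "(i, j) \<in> \<Omega>" for i j
      using regular_acyclic_array_pos[OF acyclic deg size B that] .
    have zero: "B i j = 0" if "(i, j) \<notin> \<Omega>" for i j
      using B that unfolding has_marginals_def by blast
    have "B i j \<ge> 0" for i j using pos[of i j] zero[of i j] by fastforce
    then have "A \<in> doubly_stochastic_arrays"
      using B unfolding doubly_stochastic_arrays_def has_marginals_def A_def by simp
    moreover have supp: "matrix_support A = \<Omega>"
      unfolding matrix_support_def A_def using pos zero by force
    ultimately show "\<exists>A :: real ^ 'm ^ 'n. extremal_array A \<and> matrix_support A = \<Omega>"
      using acyclic_support_extremal acyclic by blast
  qed
qed

end
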